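(* Let $W$ be a rank two finite Coxeter group acting in its reflection representation $V=\mathbf{k}^2$. Then, for any multiplicity function $m\in\mathcal{M}(W)$, $\mathbf{Q}_m(W)$ is a free $\mathbf{k}[V]$-module of rank $|W|$.
   Context: $\mathbf{k}$ is a field of characteristic zero. Let $\mathcal{A}$ be the set of reflection hyperplanes of $W$ in $V$; for each fix a linear form $\alpha\in V^*$ defining it (we write $\alpha\in\mathcal{A}$), and let $s_\alpha\in W$ be the corresponding reflection. $\mathcal{M}(W)$ is the set of $W$-invariant functions $m:\mathcal{A}\to\mathbb{Z}_{\ge0}$, $\alpha\mapsto m_\alpha$ (possibly with some values even and some odd). The algebra of $m$-quasi-covariants is $\mathbf{Q}_m(W)=\{(p_w)_{w\in W}\in\prod_{w\in W}\mathbf{k}[V]: p_w\equiv p_{s_\alpha w}\bmod\langle\alpha\rangle^{m_\alpha}\ \forall\,\alpha\in\mathcal{A},\ w\in W\}$. It is a $\mathbf{k}[V]$-module via the diagonal inclusion $f\mapsto(f)_{w\in W}$. *)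

theory Defs
  imports
    "HOL-Analysis.Cartesian_Space"
    "HOL-Algebra.Generated_Groups"
    "HOL-Computational_Algebra.Polynomial"
    "HOL-Library.Function_Algebras"
begin

section \<open>Coxeter systems\<close>

text \<open>
  A Coxeter matrix on \<open>S\<close>; the value \<open>0\<close> encodes \<open>\<infinity>\<close>.
\<close>

definition coxeter_matrix :: "'g set \<Rightarrow> ('g \<Rightarrow> 'g \<Rightarrow> nat) \<Rightarrow> bool" where
  "coxeter_matrix S M \<longleftrightarrow>
     (\<forall>s\<in>S. \<forall>t\<in>S. M s t = M t s \<and> (M s t = 1 \<longleftrightarrow> s = t))"

text \<open>
  Deleting one relator \<open>(s t)^(M s t)\<close> from a word. If \<open>M s t = 0\<close> the relator is the empty
  word, so there is no relation. The relators with \<open>s = t\<close> are \<open>s s\<close>, so that a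
  generator is its own inverse and words in \<open>S\<close> alone suffice to present the group.
\<close>

inductive coxeter_step :: "'g set \<Rightarrow> ('g \<Rightarrow> 'g \<Rightarrow> nat) \<Rightarrow> 'g list \<Rightarrow> 'g list \<Rightarrow> bool"
  for S :: "'g set" and M :: "'g \<Rightarrow> 'g \<Rightarrow> nat" where
  "s \<in> S \<Longrightarrow> t \<in> S \<Longrightarrow>
     coxeter_step S M (u @ concat (replicate (M s t) [s, t]) @ v) (u @ v)"

definition word_value :: "('g, 'b) monoid_scheme \<Rightarrow> 'g list \<Rightarrow> 'g" where
  "word_value G u = foldr (\<lambda>x y. x \<otimes>\<^bsub>G\<^esub> y) u \<one>\<^bsub>G\<^esub>"

text \<open>
  \<open>(G, S)\<close> is a Coxeter system: \<open>G\<close> has the presentation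
  \<open>\<langle>S | (s t)^(M s t) = 1\<rangle>\<close> for some Coxeter matrix \<open>M\<close>. Its rank is \<open>card S\<close>.
\<close>

definition coxeter_system :: "('g, 'b) monoid_scheme \<Rightarrow> 'g set \<Rightarrow> bool" where
  "coxeter_system G S \<longleftrightarrow>
     group G \<and> S \<subseteq> carrier G \<and> generate G S = carrier G \<and>
     (\<exists>M. coxeter_matrix S M \<and>
        (\<forall>u\<in>lists S. \<forall>v\<in>lists S.
           word_value G u = word_value G v \<longleftrightarrow> equivclp (coxeter_step S M) u v))"


section \<open>Reflection representations\<close>

definition GL :: "('k::field ^ 'n ^ 'n) monoid" where
  "GL = \<lparr>carrier = {A. invertible A}, monoid.mult = (**), one = mat 1\<rparr>"

definition fixed_space :: "'k::field ^ 'n ^ 'n \<Rightarrow> ('k ^ 'n) set" where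
  "fixed_space s = {v. s *v v = v}"

definition is_reflection :: "'k::field ^ 'n ^ 'n \<Rightarrow> bool" where
  "is_reflection s \<longleftrightarrow> s ** s = mat 1 \<and> vec.dim (fixed_space s) + 1 = CARD('n)"

text \<open>
  A finite Coxeter group with Coxeter generators \<open>S\<close>, given as a subgroup of \<open>GL(V)\<close> through
  its reflection representation: the generators act as reflections and \<open>dim V\<close> is the rank.
  Over a general field of characteristic zero there is no distinguished choice of the numbers
  \<open>2 cos (\<pi> / M s t)\<close>, so no particular matrices are prescribed for the generators.
\<close>

definition finite_coxeter_reflection_group ::
    "('k::field_char_0 ^ 'n ^ 'n) set \<Rightarrow> ('k ^ 'n ^ 'n) set \<Rightarrow> bool" where
  "finite_coxeter_reflection_group W S \<longleftrightarrow>
     finite W \<and> subgroup W GL \<and>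
     coxeter_system (GL\<lparr>carrier := W\<rparr>) S \<and>
     (\<forall>s\<in>S. is_reflection s) \<and> card S = CARD('n)"

definition reflection_hyperplanes :: "('k::field ^ 'n ^ 'n) set \<Rightarrow> ('k ^ 'n) set set" where
  "reflection_hyperplanes W = {fixed_space s | s. s \<in> W \<and> is_reflection s}"

text \<open>
  In a finite group \<open>W\<close> over a field of characteristic zero the reflection with a given
  reflection hyperplane is unique: the product of two such reflections is unipotent.
\<close>

definition hyperplane_reflection ::
    "('k::field ^ 'n ^ 'n) set \<Rightarrow> ('k ^ 'n) set \<Rightarrow> 'k ^ 'n ^ 'n" where
  "hyperplane_reflection W H = (THE s. s \<in> W \<and> is_reflection s \<and> fixed_space s = H)"

text \<open>
  A vector \<open>a\<close> of coefficients stands for the linear form \<open>v \<mapsto> \<Sum>i. a $ i * v $ i\<close>. A choice of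
  defining forms assigns to each reflection hyperplane a form with that hyperplane as kernel.
\<close>

definition defining_forms ::
    "('k::field ^ 'n ^ 'n) set \<Rightarrow> (('k ^ 'n) set \<Rightarrow> 'k ^ 'n) \<Rightarrow> bool" where
  "defining_forms W \<alpha> \<longleftrightarrow>
     (\<forall>H\<in>reflection_hyperplanes W. {v. (\<Sum>i\<in>UNIV. \<alpha> H $ i * v $ i) = 0} = H)"

definition multiplicity_function ::
    "('k::field ^ 'n ^ 'n) set \<Rightarrow> (('k ^ 'n) set \<Rightarrow> nat) \<Rightarrow> bool" where
  "multiplicity_function W m \<longleftrightarrow>
     (\<forall>w\<in>W. \<forall>H\<in>reflection_hyperplanes W. m ((*v) w ` H) = m H)"


section \<open>Quasi-covariants\<close>

text \<open>
  For \<open>V = k^2\<close> the ring \<open>k[V] = k[x, y]\<close> is rendered as \<open>k[x][y]\<close>, the type \<open>'k poly poly\<close>,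
  with \<open>x = [:[:0, 1:]:]\<close> and \<open>y = [:0, 1:]\<close>; below is the linear form \<open>a\<^sub>1 x + a\<^sub>2 y\<close>.
\<close>

definition linear_form :: "'k::field ^ 2 \<Rightarrow> 'k poly poly" where
  "linear_form a = [:[:0, a $ 1:], [:a $ 2:]:]"

text \<open>
  Elements of the product of copies of \<open>k[V]\<close> indexed by \<open>W\<close> are functions on all matrices
  that vanish outside \<open>W\<close>. The ideal power is principal, generated by the power of the form.
\<close>

definition quasi_covariants ::
    "('k::field ^ 2 ^ 2) set \<Rightarrow> (('k ^ 2) set \<Rightarrow> 'k ^ 2) \<Rightarrow> (('k ^ 2) set \<Rightarrow> nat) \<Rightarrow>
     ('k ^ 2 ^ 2 \<Rightarrow> 'k poly poly) set" where
  "quasi_covariants W \<alpha> m =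
     {p. (\<forall>w. w \<notin> W \<longrightarrow> p w = 0) \<and>
         (\<forall>H\<in>reflection_hyperplanes W. \<forall>w\<in>W.
            linear_form (\<alpha> H) ^ m H dvd p w - p (hyperplane_reflection W H ** w))}"

definition diag_scale :: "'r::comm_ring_1 \<Rightarrow> ('w \<Rightarrow> 'r) \<Rightarrow> 'w \<Rightarrow> 'r" where
  "diag_scale f p = (\<lambda>w. f * p w)"

lemma module_diag_scale: "module (diag_scale :: 'r::comm_ring_1 \<Rightarrow> ('w \<Rightarrow> 'r) \<Rightarrow> 'w \<Rightarrow> 'r)"
  by unfold_locales (auto simp: diag_scale_def fun_eq_iff algebra_simps)

lemma subspace_quasi_covariants:
  "module.subspace diag_scale (quasi_covariants W \<alpha> m)"
proof -
  have dvd_add_diff: "d dvd (a + b) - (a' + b')"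
    if "d dvd a - a'" "d dvd b - b'" for d a a' b b' :: "'a poly poly"
    using dvd_add[OF that] by (simp add: algebra_simps)
  have dvd_mult_diff: "d dvd c * a - c * a'" if "d dvd a - a'" for d a a' c :: "'a poly poly"
    using dvd_mult[OF that, of c] by (simp add: algebra_simps)
  show ?thesis
    by (auto simp: module.subspace_def[OF module_diag_scale] quasi_covariants_def diag_scale_def
        intro!: dvd_add_diff dvd_mult_diff)
qed

definition free_module_of_rank ::
    "('r::comm_ring_1 \<Rightarrow> 'b::ab_group_add \<Rightarrow> 'b) \<Rightarrow> 'b set \<Rightarrow> nat \<Rightarrow> bool" where
  "free_module_of_rank smul N r \<longleftrightarrow>
     (\<exists>B. finite B \<and> card B = r \<and> \<not> module.dependent smul B \<and> module.span smul B = N)"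

end

theory Submission
  imports Defs
begin

text \<open>
  Impose the divisibility conditions one factor at a time, starting from the free module of all
  functions on \<open>W\<close>. If \<open>N\<close> is free and \<open>l ^ n\<close> divides \<open>p a - p b\<close> for all \<open>p \<in> N\<close>, then the
  submodule where \<open>l ^ (n + 1)\<close> divides \<open>p a - p b\<close> is the kernel of the map
  \<open>p \<mapsto> (p a - p b) / l ^ n\<close> from \<open>N\<close> to \<open>k[V] / (l)\<close>. For a linear form \<open>l\<close> this quotient is
  isomorphic to the Euclidean ring \<open>k[t]\<close>, so Euclid's algorithm, performed by elementary
  operations on a basis of \<open>N\<close>, makes all but one basis vector lie in the kernel. Multiplying the
  remaining one by \<open>l\<close> gives a basis of the kernel with the same number of elements.
\<close>

section \<open>Indexed bases and elementary operations on them\<close>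

locale idom_module = module scale
  for scale :: "'a::idom \<Rightarrow> 'b::ab_group_add \<Rightarrow> 'b" (infixr "\<star>" 75)
begin

text \<open>A family rather than a set of vectors: an operation can replace one entry in place, and
  the rank is read off the unchanged index set.\<close>

definition basis_family :: "'i set \<Rightarrow> ('i \<Rightarrow> 'b) \<Rightarrow> 'b set \<Rightarrow> bool" where
  "basis_family I b N \<longleftrightarrow>
     N = range (\<lambda>f. \<Sum>i\<in>I. f i \<star> b i) \<and>
     (\<forall>f. (\<Sum>i\<in>I. f i \<star> b i) = 0 \<longrightarrow> (\<forall>i\<in>I. f i = 0))"

lemma basis_family_mem:
  assumes "basis_family I b N" "finite I" "i \<in> I"
  shows "b i \<in> N"
proof -
  have "b i = (\<Sum>j\<in>I. (if j = i then 1 else 0) \<star> b j)"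
    using assms(2,3) by (simp add: if_distrib[of "\<lambda>c. c \<star> _"] sum.delta cong: if_cong)
  then show ?thesis
    using assms(1) by (auto simp: basis_family_def)
qed

lemma basis_family_subspace:
  assumes "basis_family I b N"
  shows "subspace N"
proof -
  have N: "N = range (\<lambda>f. \<Sum>i\<in>I. f i \<star> b i)"
    using assms by (simp add: basis_family_def)
  show ?thesis
  proof (rule subspaceI)
    show "0 \<in> N"
      unfolding N by (rule range_eqI[of _ _ "\<lambda>_. 0"]) simp
  next
    fix x y assume "x \<in> N" "y \<in> N"
    then obtain f g where "x = (\<Sum>i\<in>I. f i \<star> b i)" "y = (\<Sum>i\<in>I. g i \<star> b i)"
      unfolding N by blast
    then show "x + y \<in> N"
      unfolding N by (intro range_eqI[of _ _ "\<lambda>i. f i + g i"])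
        (simp add: scale_left_distrib sum.distrib)
  next
    fix c x assume "x \<in> N"
    then obtain f where "x = (\<Sum>i\<in>I. f i \<star> b i)"
      unfolding N by blast
    then show "c \<star> x \<in> N"
      unfolding N by (intro range_eqI[of _ _ "\<lambda>i. c * f i"]) (simp add: scale_sum_right)
  qed
qed

text \<open>Replacing \<open>b i\<close> by \<open>b i + c \<star> b j\<close> amounts to adding
  \<open>c * f i\<close> to the coefficient \<open>f j\<close>. This substitution is undone by
  subtracting \<open>c * f i\<close>, so both span and independence survive.\<close>

lemma basis_family_elementary:
  assumes b: "basis_family I b N" and I: "finite I" "i \<in> I" "j \<in> I" "i \<noteq> j"
  shows "basis_family I (b(i := b i + c \<star> b j)) N"
proof -
  let ?b = "b(i := b i + c \<star> b j)"
  have N: "N = range (\<lambda>f. \<Sum>k\<in>I. f k \<star> b k)"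
    and indep: "\<And>f. (\<Sum>k\<in>I. f k \<star> b k) = 0 \<Longrightarrow> \<forall>k\<in>I. f k = 0"
    using b by (auto simp: basis_family_def)
  have split: "(\<Sum>k\<in>I. h k) = h i + (h j + (\<Sum>k\<in>I - {i} - {j}. h k))" for h :: "_ \<Rightarrow> 'b"
    using I by (simp add: sum.remove[of I i] sum.remove[of "I - {i}" j])
  have eq: "(\<Sum>k\<in>I. f k \<star> ?b k) = (\<Sum>k\<in>I. (f(j := f j + c * f i)) k \<star> b k)" for f
  proof -
    have "(\<Sum>k\<in>I - {i} - {j}. f k \<star> ?b k) =
        (\<Sum>k\<in>I - {i} - {j}. (f(j := f j + c * f i)) k \<star> b k)"
      by (rule sum.cong) auto
    then show ?thesis
      unfolding split using I(4)
      by (simp add: scale_left_distrib scale_right_distrib algebra_simps)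
  qed
  have eq': "(\<Sum>k\<in>I. f k \<star> b k) = (\<Sum>k\<in>I. (f(j := f j - c * f i)) k \<star> ?b k)" for f
    unfolding eq using I(4) by (intro sum.cong) auto
  have "(\<Sum>k\<in>I. f k \<star> ?b k) \<in> N" for f
    unfolding eq N by blast
  moreover have "x \<in> range (\<lambda>f. \<Sum>k\<in>I. f k \<star> ?b k)" if "x \<in> N" for x
    using that unfolding N eq' by blast
  moreover have "\<forall>k\<in>I. f k = 0" if "(\<Sum>k\<in>I. f k \<star> ?b k) = 0" for f
  proof -
    have *: "\<forall>k\<in>I. (f(j := f j + c * f i)) k = 0"
      using that unfolding eq by (rule indep)
    \<comment> \<open>The coefficient at \<open>i\<close> is not altered by the substitution since
      \<open>i\<close> differs from \<open>j\<close>; once it vanishes, the correction at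
      \<open>j\<close> vanishes too.\<close>
    then have "f i = 0"
      using I by (metis fun_upd_other)
    with * show ?thesis
      by (auto split: if_splits)
  qed
  ultimately show ?thesis
    unfolding basis_family_def by blast
qed

text \<open>Passing from the family to the set of its values loses no element: two equal entries
  would satisfy a relation with coefficients 1 and -1.\<close>

lemma basis_family_free:
  assumes b: "basis_family I b N" and "finite I"
  shows "free_module_of_rank scale N (card I)"
proof -
  have N: "N = range (\<lambda>f. \<Sum>k\<in>I. f k \<star> b k)"
    and indep: "\<And>f. (\<Sum>k\<in>I. f k \<star> b k) = 0 \<Longrightarrow> \<forall>k\<in>I. f k = 0"
    using b by (auto simp: basis_family_def)
  have inj: "inj_on b I"
  proof (rule inj_onI, rule ccontr)
    fix i j assume ij: "i \<in> I" "j \<in> I" "b i = b j" "i \<noteq> j"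
    let ?f = "\<lambda>k. (if k = i then 1 else 0) - (if k = j then 1 else 0) :: 'a"
    have "(\<Sum>k\<in>I. ?f k \<star> b k) = b i - b j"
      using ij \<open>finite I\<close>
      by (simp add: scale_left_diff_distrib sum_subtractf if_distrib[of "\<lambda>c. c \<star> _"]
          sum.delta cong: if_cong)
    then have "\<forall>k\<in>I. ?f k = 0"
      using ij(3) indep[of ?f] by simp
    with ij show False
      by auto
  qed
  have sum_image: "(\<Sum>v\<in>b ` I. u v \<star> v) = (\<Sum>i\<in>I. u (b i) \<star> b i)" for u
    by (simp add: sum.reindex[OF inj])
  have "span (b ` I) = N"
  proof -
    have "(\<Sum>i\<in>I. f i \<star> b i) \<in> range (\<lambda>u. \<Sum>v\<in>b ` I. u v \<star> v)" for f
      by (rule range_eqI[of _ _ "\<lambda>v. f (the_inv_into I b v)"])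
        (simp add: sum_image the_inv_into_f_f[OF inj])
    then show ?thesis
      unfolding N span_finite[OF finite_imageI[OF \<open>finite I\<close>]] by (auto simp: sum_image)
  qed
  moreover have "independent (b ` I)"
    using indep[of "\<lambda>i. u (b i)" for u] \<open>finite I\<close>
    by (force simp: dependent_finite sum_image)
  ultimately show ?thesis
    unfolding free_module_of_rank_def
    using \<open>finite I\<close> card_image[OF inj] by blast
qed

end

section \<open>Euclid's algorithm on a basis, and kernels of semilinear functionals\<close>

text \<open>\<open>\<psi>\<close> models the quotient map modulo \<open>l\<close>, and
  \<open>\<phi>\<close> is semilinear over it. Linearity is asked only on \<open>N\<close> because
  the intended \<open>\<phi>\<close> divides by a power of \<open>l\<close>, which is exact only
  there.\<close>

locale euclidean_functional = idom_module scale
  for scale :: "'a::idom \<Rightarrow> 'b::ab_group_add \<Rightarrow> 'b" (infixr "\<star>" 75) +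
  fixes \<psi> :: "'a \<Rightarrow> 'e::euclidean_ring" and l :: 'a and \<phi> :: "'b \<Rightarrow> 'e" and N :: "'b set"
  assumes surj: "surj \<psi>"
    and ker: "\<psi> c = 0 \<longleftrightarrow> l dvd c"
    and l_nonzero: "l \<noteq> 0"
    and \<phi>_add: "x \<in> N \<Longrightarrow> y \<in> N \<Longrightarrow> \<phi> (x + y) = \<phi> x + \<phi> y"
    and \<phi>_scale: "x \<in> N \<Longrightarrow> \<phi> (c \<star> x) = \<psi> c * \<phi> x"
begin

lemma \<phi>_sum:
  assumes "subspace N" "finite J" "\<And>i. i \<in> J \<Longrightarrow> b i \<in> N"
  shows "\<phi> (\<Sum>i\<in>J. f i \<star> b i) = (\<Sum>i\<in>J. \<psi> (f i) * \<phi> (b i))"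
  using assms(2,3)
proof (induction J)
  case empty
  have "\<phi> (0 + 0) = \<phi> 0 + \<phi> 0"
    using subspace_0[OF assms(1)] by (intro \<phi>_add)
  then have "\<phi> 0 = 0"
    by (metis add.right_neutral add_left_cancel)
  then show ?case
    by simp
next
  case (insert i J)
  then have "(\<Sum>i\<in>J. f i \<star> b i) \<in> N" "f i \<star> b i \<in> N"
    using assms(1) by (auto intro!: subspace_sum subspace_scale)
  with insert show ?case
    by (simp add: \<phi>_add \<phi>_scale)
qed

text \<open>While two entries have nonzero values under \<open>\<phi>\<close>, one division with
  remainder lowers the total Euclidean size of the values, so the process stops.\<close>

lemma euclid_basis_family:
  assumes "basis_family I b N" "finite I"
  obtains b' where "basis_family I b' N"
    "\<And>i j. i \<in> I \<Longrightarrow> j \<in> I \<Longrightarrow> \<phi> (b' i) \<noteq> 0 \<Longrightarrow> \<phi> (b' j) \<noteq> 0 \<Longrightarrow> i = j"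
proof -
  have "\<exists>b'. basis_family I b' N \<and>
      (\<forall>i\<in>I. \<forall>j\<in>I. \<phi> (b' i) \<noteq> 0 \<longrightarrow> \<phi> (b' j) \<noteq> 0 \<longrightarrow> i = j)"
    using assms(1)
  proof (induction "\<Sum>i\<in>I. euclidean_size (\<phi> (b i))" arbitrary: b rule: less_induct)
    case less
    show ?case
    proof (cases "\<forall>i\<in>I. \<forall>j\<in>I. \<phi> (b i) \<noteq> 0 \<longrightarrow> \<phi> (b j) \<noteq> 0 \<longrightarrow> i = j")
      case True
      with less.prems show ?thesis
        by blast
    next
      case False
      \<comment> \<open>The two indices are named so that \<open>j\<close> has the value of smaller
        or equal size and serves as divisor.\<close>
      then obtain i j where ij: "i \<in> I" "j \<in> I" "i \<noteq> j" "\<phi> (b i) \<noteq> 0" "\<phi> (b j) \<noteq> 0"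
        "euclidean_size (\<phi> (b j)) \<le> euclidean_size (\<phi> (b i))"
        by (metis linear)
      \<comment> \<open>Surjectivity of \<open>\<psi>\<close> lifts the negated quotient to a
        scalar, so that the elementary operation turns \<open>\<phi> (b i)\<close> into the
        remainder.\<close>
      obtain c where c: "\<psi> c = - (\<phi> (b i) div \<phi> (b j))"
        using surj by (metis surjD)
      let ?b = "b(i := b i + c \<star> b j)"
      have b: "basis_family I ?b N"
        using less.prems assms(2) ij by (intro basis_family_elementary)
      have mem: "b i \<in> N" "b j \<in> N"
        using basis_family_mem[OF less.prems assms(2)] ij by auto
      then have "c \<star> b j \<in> N"
        using basis_family_subspace[OF less.prems] subspace_scale by blast
      then have "\<phi> (b i + c \<star> b j) = \<phi> (b i) mod \<phi> (b j)"
        using mem by (simp add: \<phi>_add \<phi>_scale c minus_div_mult_eq_mod [symmetric])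
      then have "euclidean_size (\<phi> (?b i)) < euclidean_size (\<phi> (b i))"
        using mod_size_less[OF ij(5), of "\<phi> (b i)"] ij(6) by simp
      moreover have "\<And>k. k \<in> I \<Longrightarrow> euclidean_size (\<phi> (?b k)) \<le> euclidean_size (\<phi> (b k))"
        using calculation by auto
      ultimately have "(\<Sum>k\<in>I. euclidean_size (\<phi> (?b k))) < (\<Sum>k\<in>I. euclidean_size (\<phi> (b k)))"
        using assms(2) ij(1) by (intro sum_strict_mono_ex1) blast+
      then show ?thesis
        using less.hyps b by blast
    qed
  qed
  then show ?thesis
    using that by blast
qed

text \<open>After Euclid's algorithm at most one entry \<open>b i\<close> has a nonzero value.
  Membership in the kernel then constrains only the coefficient at \<open>i\<close>, which must be a
  multiple of \<open>l\<close>; so \<open>l \<star> b i\<close> replaces \<open>b i\<close>.\<close>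

lemma kernel_basis_family:
  assumes "basis_family I b N" "finite I"
  obtains b' where "basis_family I b' {x \<in> N. \<phi> x = 0}"
proof -
  obtain b where b: "basis_family I b N"
    and uniq: "\<And>i j. i \<in> I \<Longrightarrow> j \<in> I \<Longrightarrow> \<phi> (b i) \<noteq> 0 \<Longrightarrow> \<phi> (b j) \<noteq> 0 \<Longrightarrow> i = j"
    using euclid_basis_family[OF assms] by blast
  have N: "N = range (\<lambda>f. \<Sum>k\<in>I. f k \<star> b k)"
    and indep: "\<And>f. (\<Sum>k\<in>I. f k \<star> b k) = 0 \<Longrightarrow> \<forall>k\<in>I. f k = 0"
    using b by (auto simp: basis_family_def)
  have \<phi>: "\<phi> (\<Sum>i\<in>I. f i \<star> b i) = (\<Sum>i\<in>I. \<psi> (f i) * \<phi> (b i))" for f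
    using basis_family_subspace[OF b] basis_family_mem[OF b assms(2)] assms(2)
    by (intro \<phi>_sum)
  show ?thesis
  proof (cases "\<forall>i\<in>I. \<phi> (b i) = 0")
    case True
    then have "\<phi> x = 0" if "x \<in> N" for x
      using that unfolding N by (auto simp: \<phi>)
    then have "{x \<in> N. \<phi> x = 0} = N"
      by blast
    with b that show ?thesis
      by simp
  next
    case False
    then obtain i where i: "i \<in> I" "\<phi> (b i) \<noteq> 0"
      by blast
    let ?b = "b(i := l \<star> b i)"
    have eq: "(\<Sum>k\<in>I. f k \<star> ?b k) = (\<Sum>k\<in>I. (f(i := l * f i)) k \<star> b k)" for f
      by (intro sum.cong) (auto simp: mult.commute)
    have "\<phi> (\<Sum>k\<in>I. f k \<star> b k) = \<psi> (f i) * \<phi> (b i)" for f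
    proof -
      have "\<psi> (f k) * \<phi> (b k) = 0" if "k \<in> I - {i}" for k
        using that uniq[of i k] i by auto
      then have "(\<Sum>k\<in>I - {i}. \<psi> (f k) * \<phi> (b k)) = 0"
        by (rule sum.neutral[OF ballI])
      then show ?thesis
        unfolding \<phi> using assms(2) i(1) by (simp add: sum.remove[of I i])
    qed
    \<comment> \<open>The target of \<open>\<phi>\<close> has no zero divisors, so the product
      vanishes only if \<open>\<psi> (f i)\<close> does.\<close>
    then have iff: "\<phi> (\<Sum>k\<in>I. f k \<star> b k) = 0 \<longleftrightarrow> l dvd f i" for f
      using i(2) by (simp add: ker)
    have "(\<Sum>k\<in>I. f k \<star> ?b k) \<in> {x \<in> N. \<phi> x = 0}" for f
      unfolding eq mem_Collect_eq iff by (auto simp: N)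
    moreover have "x \<in> range (\<lambda>f. \<Sum>k\<in>I. f k \<star> ?b k)" if x: "x \<in> {x \<in> N. \<phi> x = 0}" for x
    proof -
      obtain f where f: "x = (\<Sum>k\<in>I. f k \<star> b k)"
        using x N by blast
      then obtain g where "f i = l * g"
        using x iff by auto
      then show ?thesis
        unfolding f eq by (intro range_eqI[of _ _ "f(i := g)"] sum.cong) auto
    qed
    moreover have "\<forall>k\<in>I. f k = 0" if "(\<Sum>k\<in>I. f k \<star> ?b k) = 0" for f
      using indep[OF that[unfolded eq]] l_nonzero by (auto split: if_splits)
    ultimately have "basis_family I ?b {x \<in> N. \<phi> x = 0}"
      unfolding basis_family_def by blast
    with that show ?thesis
      by blast
  qed
qed

end

section \<open>Congruences between two values of a function\<close>

interpretation diag: idom_module "diag_scale :: 'r::idom \<Rightarrow> ('w \<Rightarrow> 'r) \<Rightarrow> 'w \<Rightarrow> 'r"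
  by (rule idom_module.intro) (rule module_diag_scale)

lemma basis_family_supported:
  assumes "finite I"
  shows "diag.basis_family I (\<lambda>i j. if i = j then 1 else 0)
    {p :: 'w \<Rightarrow> 'r::idom. \<forall>w. w \<notin> I \<longrightarrow> p w = 0}"
proof -
  have eq: "(\<Sum>i\<in>I. diag_scale (f i) (\<lambda>j. if i = j then 1 else 0)) =
      (\<lambda>j. if j \<in> I then f j else 0)" for f :: "'w \<Rightarrow> 'r"
  proof
    fix j
    have "(\<Sum>i\<in>J. g i) j = (\<Sum>i\<in>J. g i j)" if "finite J" for J and g :: "'w \<Rightarrow> 'w \<Rightarrow> 'r"
      using that by induction auto
    with assms show "(\<Sum>i\<in>I. diag_scale (f i) (\<lambda>j. if i = j then 1 else 0)) j =
        (if j \<in> I then f j else 0)"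
      by (simp add: diag_scale_def if_distrib[of "\<lambda>c. _ * c"] sum.delta' cong: if_cong)
  qed
  show ?thesis
    unfolding diag.basis_family_def eq by (force simp: fun_eq_iff)
qed

text \<open>Induction on the exponent. Given exact divisibility by \<open>l ^ n\<close>, one more
  factor of \<open>l\<close> is the vanishing modulo \<open>l\<close> of the quotient, which is a
  kernel condition and keeps the index set \<open>I\<close>.\<close>

lemma basis_family_congruence:
  fixes l :: "'r::{idom_divide, algebraic_semidom}" and \<psi> :: "'r \<Rightarrow> 'e::euclidean_ring"
  assumes "diag.basis_family I b N" "finite I"
    and \<psi>: "surj \<psi>" "\<And>c. \<psi> c = 0 \<longleftrightarrow> l dvd c"
      "\<And>c d. \<psi> (c + d) = \<psi> c + \<psi> d" "\<And>c d. \<psi> (c * d) = \<psi> c * \<psi> d"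
    and l: "l \<noteq> 0"
  shows "\<exists>b'. diag.basis_family I b' {p \<in> N. l ^ n dvd p u - p v}"
proof (induction n)
  case 0
  then show ?case
    using assms(1) by auto
next
  case (Suc n)
  let ?M = "{p \<in> N. l ^ n dvd p u - p v}"
  let ?\<phi> = "\<lambda>p. \<psi> ((p u - p v) div l ^ n)"
  obtain b' where b': "diag.basis_family I b' ?M"
    using Suc by blast
  interpret euclidean_functional diag_scale \<psi> l ?\<phi> ?M
  proof unfold_locales
    fix x y assume "x \<in> ?M" "y \<in> ?M"
    then have "((x u - x v) + (y u - y v)) div l ^ n = (x u - x v) div l ^ n + (y u - y v) div l ^ n"
      by (intro div_add) auto
    then show "?\<phi> (x + y) = ?\<phi> x + ?\<phi> y"
      by (simp add: \<psi>(3)[symmetric] algebra_simps)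
  next
    fix x c assume "x \<in> ?M"
    then have "c * (x u - x v) div l ^ n = c * ((x u - x v) div l ^ n)"
      by (simp add: div_mult_swap)
    then show "?\<phi> (diag_scale c x) = \<psi> c * ?\<phi> x"
      by (simp add: \<psi>(4)[symmetric] diag_scale_def right_diff_distrib)
  qed (use \<psi> l in auto)
  \<comment> \<open>This identifies the next congruence with the kernel of \<open>?\<phi>\<close> on
    \<open>?M\<close>.\<close>
  have "l ^ Suc n dvd d \<longleftrightarrow> l ^ n dvd d \<and> \<psi> (d div l ^ n) = 0" for d
  proof
    assume *: "l ^ Suc n dvd d"
    then have "l ^ n dvd d"
      by (rule dvd_trans[rotated]) simp
    moreover obtain k where "d = l ^ n * (l * k)"
      using * by (metis dvdE power_Suc2 mult.assoc)
    ultimately show "l ^ n dvd d \<and> \<psi> (d div l ^ n) = 0"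
      unfolding \<psi>(2) using l by simp
  next
    assume "l ^ n dvd d \<and> \<psi> (d div l ^ n) = 0"
    with l show "l ^ Suc n dvd d"
      unfolding \<psi>(2) by (auto elim!: dvdE)
  qed
  then have "{p \<in> N. l ^ Suc n dvd p u - p v} = {p \<in> ?M. ?\<phi> p = 0}"
    by blast
  then show ?case
    using kernel_basis_family[OF b' assms(2)] by metis
qed

section \<open>Linear forms in two variables and the quasi-covariants\<close>

text \<open>\<open>\<psi>\<close> is restriction to the line where the form vanishes. If
  \<open>a $ 2\<close> is nonzero, the line is a graph over the x-axis and one substitutes for y;
  otherwise it is x = 0, and x is set to 0 in every coefficient.\<close>

lemma linear_form_quotient:
  fixes a :: "'k::field ^ 2"
  assumes "a \<noteq> 0"
  obtains \<psi> :: "'k poly poly \<Rightarrow> 'k poly" where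
    "surj \<psi>" "\<And>c. \<psi> c = 0 \<longleftrightarrow> linear_form a dvd c"
    "\<And>c d. \<psi> (c + d) = \<psi> c + \<psi> d" "\<And>c d. \<psi> (c * d) = \<psi> c * \<psi> d"
proof (cases "a $ 2 = 0")
  case False
  let ?t = "[:0, - (a $ 1 / a $ 2):]"
  have "linear_form a = [:[:a $ 2:]:] * [:- ?t, 1:]"
    using False by (simp add: linear_form_def)
  moreover have "is_unit [:[:a $ 2:]:]"
    using False by (simp add: is_unit_const_poly_iff dvd_field_iff)
  \<comment> \<open>Up to a unit the form is y minus \<open>?t\<close>, so divisibility is the
    factor theorem over k[x].\<close>
  ultimately have "poly c ?t = 0 \<longleftrightarrow> linear_form a dvd c" for c
    by (simp only: poly_eq_0_iff_dvd mult_unit_dvd_iff')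
  moreover have "surj (\<lambda>c. poly c ?t)"
    by (rule surjI[of _ "\<lambda>c. [:c:]"]) simp
  ultimately show ?thesis
    using that[of "\<lambda>c. poly c ?t"] by simp
next
  case True
  then have a1: "a $ 1 \<noteq> 0"
    using assms by (auto simp: vec_eq_iff forall_2)
  let ?\<psi> = "map_poly (\<lambda>c. poly c 0) :: 'k poly poly \<Rightarrow> 'k poly"
  have coeff: "coeff (?\<psi> c) n = poly (coeff c n) 0" for c n
    by (simp add: coeff_map_poly)
  have "linear_form a = [:[:0, a $ 1:]:]"
    using True by (simp add: linear_form_def)
  moreover have "[:0, a $ 1:] = [:a $ 1:] * [:- 0, 1:]"
    by simp
  moreover have unit: "is_unit [:a $ 1:]"
    using a1 by (simp add: is_unit_const_poly_iff dvd_field_iff)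
  \<comment> \<open>The form is constant in y, so it divides \<open>c\<close> exactly when x divides
    each coefficient, that is, when each coefficient vanishes at 0.\<close>
  ultimately have "linear_form a dvd c \<longleftrightarrow> (\<forall>n. poly (coeff c n) 0 = 0)" for c
    by (simp only: const_poly_dvd_iff poly_eq_0_iff_dvd mult_unit_dvd_iff'[OF unit])
  then have "?\<psi> c = 0 \<longleftrightarrow> linear_form a dvd c" for c
    by (simp add: poly_eq_iff coeff)
  moreover have "surj ?\<psi>"
    \<comment> \<open>The right inverse regards a polynomial in y as one whose coefficients are
      constant in x.\<close>
    by (rule surjI[of _ "map_poly (\<lambda>c. [:c:])"]) (simp add: poly_eq_iff coeff coeff_map_poly)
  moreover have "?\<psi> (c + d) = ?\<psi> c + ?\<psi> d" "?\<psi> (c * d) = ?\<psi> c * ?\<psi> d" for c d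
    by (simp_all add: poly_eq_iff coeff coeff_mult poly_sum)
  ultimately show ?thesis
    using that by blast
qed

lemma linear_form_nonzero: "a \<noteq> 0 \<Longrightarrow> linear_form a \<noteq> 0"
  by (auto simp: linear_form_def vec_eq_iff forall_2)

text \<open>Induction over the finite set of conditions: each one may shrink the module, but its
  basis stays indexed by \<open>I\<close>.\<close>

lemma basis_family_congruences:
  fixes E :: "(('k::field ^ 2) \<times> nat \<times> 'w \<times> 'w) set"
  assumes "finite E" "finite I" "\<And>a n u v. (a, n, u, v) \<in> E \<Longrightarrow> a \<noteq> 0"
  shows "\<exists>b. diag.basis_family I b {p. (\<forall>w. w \<notin> I \<longrightarrow> p w = 0) \<and>
           (\<forall>(a, n, u, v)\<in>E. linear_form a ^ n dvd p u - p v)}"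
  using assms(1,3)
proof (induction E)
  case empty
  then show ?case
    using basis_family_supported[OF assms(2)] by auto
next
  case (insert e E)
  obtain a n u v where e: "e = (a, n, u, v)"
    by (cases e)
  let ?N = "{p. (\<forall>w. w \<notin> I \<longrightarrow> p w = 0) \<and>
           (\<forall>(a, n, u, v)\<in>E. linear_form a ^ n dvd p u - p v)}"
  obtain b where b: "diag.basis_family I b ?N"
    using insert.IH insert.prems by blast
  have "a \<noteq> 0"
    using insert.prems e by blast
  then obtain \<psi> :: "'k poly poly \<Rightarrow> 'k poly" where
    "surj \<psi>" "\<And>c. \<psi> c = 0 \<longleftrightarrow> linear_form a dvd c"
    "\<And>c d. \<psi> (c + d) = \<psi> c + \<psi> d" "\<And>c d. \<psi> (c * d) = \<psi> c * \<psi> d"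
    by (rule linear_form_quotient) blast
  then have "\<exists>b'. diag.basis_family I b' {p \<in> ?N. linear_form a ^ n dvd p u - p v}"
    using b assms(2) linear_form_nonzero[OF \<open>a \<noteq> 0\<close>] by (intro basis_family_congruence)
  moreover have "{p \<in> ?N. linear_form a ^ n dvd p u - p v} =
      {p. (\<forall>w. w \<notin> I \<longrightarrow> p w = 0) \<and>
          (\<forall>(a, n, u, v)\<in>insert e E. linear_form a ^ n dvd p u - p v)}"
    by (auto simp: e)
  ultimately show ?case
    by simp
qed

text \<open>A zero form vanishes on the whole space, whereas the fixed space of a reflection has
  codimension one.\<close>

lemma defining_form_nonzero:
  fixes W :: "('k::field ^ 'n ^ 'n) set"
  assumes "defining_forms W \<alpha>" "H \<in> reflection_hyperplanes W"
  shows "\<alpha> H \<noteq> 0"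
proof
  assume "\<alpha> H = 0"
  then have "H = UNIV"
    using assms by (auto simp: defining_forms_def)
  moreover obtain s where "is_reflection s" "H = fixed_space s"
    using assms(2) by (auto simp: reflection_hyperplanes_def)
  ultimately show False
    by (auto simp: is_reflection_def vec.dim_UNIV card_cart_basis)
qed

theorem proposition2p14:
  fixes W S :: "('k::field_char_0 ^ 2 ^ 2) set"
    and \<alpha> :: "('k ^ 2) set \<Rightarrow> 'k ^ 2"
    and m :: "('k ^ 2) set \<Rightarrow> nat"
  assumes "finite_coxeter_reflection_group W S"
    and "defining_forms W \<alpha>"
    and "multiplicity_function W m"
  shows "free_module_of_rank diag_scale (quasi_covariants W \<alpha> m) (card W)"
proof -
  have W: "finite W"
    using assms(1) by (simp add: finite_coxeter_reflection_group_def)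
  \<comment> \<open>One congruence per pair of a hyperplane and a group element. Hyperplanes are
    fixed spaces of elements of the finite set \<open>W\<close>, so there are finitely many
    congruences.\<close>
  let ?edge = "\<lambda>(H, w). (\<alpha> H, m H, w, hyperplane_reflection W H ** w)"
  let ?E = "?edge ` (reflection_hyperplanes W \<times> W)"
  have "reflection_hyperplanes W \<subseteq> fixed_space ` W"
    by (auto simp: reflection_hyperplanes_def)
  then have "finite ?E"
    using W by (meson finite_SigmaI finite_imageI finite_subset)
  moreover have "a \<noteq> 0" if "(a, n, u, v) \<in> ?E" for a n u v
    using that defining_form_nonzero[OF assms(2)] by auto
  ultimately obtain b where "diag.basis_family W b {p. (\<forall>w. w \<notin> W \<longrightarrow> p w = 0) \<and>
      (\<forall>(a, n, u, v)\<in>?E. linear_form a ^ n dvd p u - p v)}"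
    using basis_family_congruences[OF _ W] by blast
  also have "{p. (\<forall>w. w \<notin> W \<longrightarrow> p w = 0) \<and>
      (\<forall>(a, n, u, v)\<in>?E. linear_form a ^ n dvd p u - p v)} = quasi_covariants W \<alpha> m"
    by (auto simp: quasi_covariants_def)
  finally show ?thesis
    using W by (rule diag.basis_family_free)
qed

end
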